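(* Let $\mu\colon\mathbf{Graph}_{\mathsf{fin}}\to\overline{\mathbb R}=[-\infty,+\infty]$ be a standard graph parameter. Then there is a graded comonad $(\mathbb C_k)_{k\in\overline{\mathbb R}}$ on the category $\mathbf{Graph}$ such that, for every finite graph $G$ and every $k\in\overline{\mathbb R}$, $\mu(G)\le k$ if and only if $G$ admits a $\mathbb C_k$-coalgebra. In particular $\kappa^{\mathbb C}(G)=\mu(G)$ for every finite graph $G$, where $\kappa^{\mathbb C}$ is the coalgebra number of $(\mathbb C_k)_k$.
   Context: $\mathbf{Graph}$ is the category of undirected loopless graphs and edge-preserving functions; $\mathbf{Graph}_{\mathsf{fin}}$ is the class of finite graphs; $+$ denotes disjoint union (binary coproduct). A graph parameter is a map $\mu\colon\mathbf{Graph}_{\mathsf{fin}}\to\overline{\mathbb R}$ taking equal values on isomorphic graphs; it is standard if $\mu(G_1+G_2)=\max\{\mu(G_1),\mu(G_2)\}$. For a comonad $(\mathbb C,\varepsilon,\delta)$, a coalgebra on $X$ is a morphism $\alpha\colon X\to\mathbb C(X)$ with $\varepsilon_X\circ\alpha=\mathrm{id}$ and $\delta_X\circ\alpha=\mathbb C(\alpha)\circ\alpha$; $X$ admits a $\mathbb C$-coalgebra if such an $\alpha$ exists. A comonad morphism $\lambda\colon\mathbb C\Rightarrow\mathbb D$ is a natural transformation with $\varepsilon^{\mathbb D}\circ\lambda=\varepsilon^{\mathbb C}$ and $\delta^{\mathbb D}\circ\lambda=\lambda\mathbb D\circ\mathbb C\lambda\circ\delta^{\mathbb C}$. A graded comonad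 here is a family of comonads $(\mathbb C_k)_{k\in\overline{\mathbb R}}$ together with comonad morphisms $g_{k,l}\colon\mathbb C_k\Rightarrow\mathbb C_l$ for all $k\le l$ in $\overline{\mathbb R}$ such that $g_{k,l}=g_{j,l}\circ g_{k,j}$ whenever $k\le j\le l$. The coalgebra number $\kappa^{\mathbb C}(G)$ of a graph $G$ is the infimum of those $k\in\overline{\mathbb R}$ for which $G$ admits a $\mathbb C_k$-coalgebra.
   Formalization: The empty graph is excluded unless μ(∅) = −∞: being initial, it admits a coalgebra for every comonad, so the claim fails there (e.g. μ constantly 0, k = −1); and Graph is taken as the graphs whose vertices lie in an arbitrary fixed infinite type. *)

theory Defs
  imports "HOL-Library.Extended_Real" "HOL-Library.FuncSet"
begin

section \<open>Undirected loopless graphs\<close>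

typedef 'a graph =
  "{(V :: 'a set, E :: ('a \<times> 'a) set). E \<subseteq> V \<times> V \<and> sym E \<and> irrefl E}"
  by (rule exI[of _ "({}, {})"]) (simp add: sym_def irrefl_def)

setup_lifting type_definition_graph

lift_definition verts :: "'a graph \<Rightarrow> 'a set" is fst .

lift_definition adj :: "'a graph \<Rightarrow> 'a \<Rightarrow> 'a \<Rightarrow> bool" is "\<lambda>(V, E) u v. (u, v) \<in> E" .

definition finite_graph :: "'a graph \<Rightarrow> bool" where
  "finite_graph G \<longleftrightarrow> finite (verts G)"

lift_definition disjoint_union :: "'a graph \<Rightarrow> 'b graph \<Rightarrow> ('a + 'b) graph" is
  "\<lambda>(V, E) (W, F). (V <+> W, map_prod Inl Inl ` E \<union> map_prod Inr Inr ` F)"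
  by (fastforce simp: sym_def irrefl_def)

definition isomorphic :: "'a graph \<Rightarrow> 'b graph \<Rightarrow> bool" where
  "isomorphic G H \<longleftrightarrow> (\<exists>f. bij_betw f (verts G) (verts H) \<and>
     (\<forall>u\<in>verts G. \<forall>v\<in>verts G. adj G u v \<longleftrightarrow> adj H (f u) (f v)))"


section \<open>Graph parameters\<close>

text \<open>Only the values of \<open>\<mu>\<close> on finite graphs matter.\<close>

definition graph_parameter :: "('a graph \<Rightarrow> ereal) \<Rightarrow> bool" where
  "graph_parameter \<mu> \<longleftrightarrow>
     (\<forall>G H. finite_graph G \<and> finite_graph H \<and> isomorphic G H \<longrightarrow> \<mu> G = \<mu> H)"

text \<open>The disjoint union of two graphs over \<open>'a\<close> lives over \<open>'a + 'a\<close>; \<open>\<mu> (G\<^sub>1 + G\<^sub>2)\<close> is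
  the value of \<open>\<mu>\<close> at any copy of it over \<open>'a\<close>. If \<open>'a\<close> is infinite, such a copy exists
  for all finite \<open>G\<^sub>1\<close>, \<open>G\<^sub>2\<close>.\<close>

definition standard_parameter :: "('a graph \<Rightarrow> ereal) \<Rightarrow> bool" where
  "standard_parameter \<mu> \<longleftrightarrow> graph_parameter \<mu> \<and>
     (\<forall>G G\<^sub>1 G\<^sub>2. finite_graph G\<^sub>1 \<and> finite_graph G\<^sub>2 \<and> isomorphic G (disjoint_union G\<^sub>1 G\<^sub>2)
        \<longrightarrow> \<mu> G = max (\<mu> G\<^sub>1) (\<mu> G\<^sub>2))"


section \<open>The category of graphs over \<open>'a\<close>\<close>

text \<open>Morphisms are extensional functions (equal to \<open>undefined\<close> outside the vertex set), so
  that equality of morphisms is equality in HOL. Composition of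
  \<open>f \<in> hom G H\<close> and \<open>g \<in> hom H K\<close> is \<open>compose (verts G) g f\<close>.\<close>

definition hom :: "'a graph \<Rightarrow> 'b graph \<Rightarrow> ('a \<Rightarrow> 'b) set" where
  "hom G H = {f \<in> verts G \<rightarrow>\<^sub>E verts H. \<forall>u v. adj G u v \<longrightarrow> adj H (f u) (f v)}"

definition ident :: "'a graph \<Rightarrow> 'a \<Rightarrow> 'a" where
  "ident G = (\<lambda>x\<in>verts G. x)"

text \<open>A function does not determine its codomain as a morphism, hence the two graph
  arguments of \<open>fmap\<close>.\<close>

record 'a endofunctor =
  fobj :: "'a graph \<Rightarrow> 'a graph"
  fmap :: "'a graph \<Rightarrow> 'a graph \<Rightarrow> ('a \<Rightarrow> 'a) \<Rightarrow> ('a \<Rightarrow> 'a)"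

definition is_endofunctor :: "('a, 'z) endofunctor_scheme \<Rightarrow> bool" where
  "is_endofunctor F \<longleftrightarrow>
     (\<forall>G H. \<forall>f\<in>hom G H. fmap F G H f \<in> hom (fobj F G) (fobj F H)) \<and>
     (\<forall>G. fmap F G G (ident G) = ident (fobj F G)) \<and>
     (\<forall>G H K. \<forall>f\<in>hom G H. \<forall>g\<in>hom H K.
        fmap F G K (compose (verts G) g f) =
        compose (verts (fobj F G)) (fmap F H K g) (fmap F G H f))"

definition id_functor :: "'a endofunctor" where
  "id_functor = \<lparr>fobj = (\<lambda>G. G), fmap = (\<lambda>G H f. f)\<rparr>"

definition comp_functor ::
    "('a, 'y) endofunctor_scheme \<Rightarrow> ('a, 'z) endofunctor_scheme \<Rightarrow> 'a endofunctor" where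
  "comp_functor F F' =
     \<lparr>fobj = (\<lambda>G. fobj F (fobj F' G)),
      fmap = (\<lambda>G H f. fmap F (fobj F' G) (fobj F' H) (fmap F' G H f))\<rparr>"

definition natural_transformation ::
    "('a, 'y) endofunctor_scheme \<Rightarrow> ('a, 'z) endofunctor_scheme \<Rightarrow>
     ('a graph \<Rightarrow> 'a \<Rightarrow> 'a) \<Rightarrow> bool" where
  "natural_transformation F F' t \<longleftrightarrow>
     (\<forall>G. t G \<in> hom (fobj F G) (fobj F' G)) \<and>
     (\<forall>G H. \<forall>f\<in>hom G H.
        compose (verts (fobj F G)) (t H) (fmap F G H f) =
        compose (verts (fobj F G)) (fmap F' G H f) (t G))"


section \<open>Comonads and coalgebras\<close>

record 'a comonad = "'a endofunctor" +
  counit :: "'a graph \<Rightarrow> 'a \<Rightarrow> 'a"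
  comult :: "'a graph \<Rightarrow> 'a \<Rightarrow> 'a"

definition is_comonad :: "'a comonad \<Rightarrow> bool" where
  "is_comonad C \<longleftrightarrow>
     is_endofunctor C \<and>
     natural_transformation C id_functor (counit C) \<and>
     natural_transformation C (comp_functor C C) (comult C) \<and>
     (\<forall>G. compose (verts (fobj C G)) (counit C (fobj C G)) (comult C G) = ident (fobj C G)) \<and>
     (\<forall>G. compose (verts (fobj C G)) (fmap C (fobj C G) G (counit C G)) (comult C G) =
          ident (fobj C G)) \<and>
     (\<forall>G. compose (verts (fobj C G)) (comult C (fobj C G)) (comult C G) =
          compose (verts (fobj C G))
            (fmap C (fobj C G) (fobj C (fobj C G)) (comult C G)) (comult C G))"

definition comonad_morphism ::
    "'a comonad \<Rightarrow> 'a comonad \<Rightarrow> ('a graph \<Rightarrow> 'a \<Rightarrow> 'a) \<Rightarrow> bool" where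
  "comonad_morphism C D t \<longleftrightarrow>
     natural_transformation C D t \<and>
     (\<forall>G. compose (verts (fobj C G)) (counit D G) (t G) = counit C G) \<and>
     (\<forall>G. compose (verts (fobj C G)) (comult D G) (t G) =
          compose (verts (fobj C G)) (t (fobj D G))
            (compose (verts (fobj C G)) (fmap C (fobj C G) (fobj D G) (t G)) (comult C G)))"

definition is_coalgebra :: "'a comonad \<Rightarrow> 'a graph \<Rightarrow> ('a \<Rightarrow> 'a) \<Rightarrow> bool" where
  "is_coalgebra C G \<alpha> \<longleftrightarrow>
     \<alpha> \<in> hom G (fobj C G) \<and>
     compose (verts G) (counit C G) \<alpha> = ident G \<and>
     compose (verts G) (comult C G) \<alpha> = compose (verts G) (fmap C G (fobj C G) \<alpha>) \<alpha>"

definition admits_coalgebra :: "'a comonad \<Rightarrow> 'a graph \<Rightarrow> bool" where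
  "admits_coalgebra C G \<longleftrightarrow> (\<exists>\<alpha>. is_coalgebra C G \<alpha>)"

definition graded_comonad ::
    "(ereal \<Rightarrow> 'a comonad) \<Rightarrow> (ereal \<Rightarrow> ereal \<Rightarrow> 'a graph \<Rightarrow> 'a \<Rightarrow> 'a) \<Rightarrow> bool" where
  "graded_comonad C g \<longleftrightarrow>
     (\<forall>k. is_comonad (C k)) \<and>
     (\<forall>k l. k \<le> l \<longrightarrow> comonad_morphism (C k) (C l) (g k l)) \<and>
     (\<forall>k j l. k \<le> j \<and> j \<le> l \<longrightarrow>
        (\<forall>G. g k l G = compose (verts (fobj (C k) G)) (g j l G) (g k j G)))"

definition coalgebra_number :: "(ereal \<Rightarrow> 'a comonad) \<Rightarrow> 'a graph \<Rightarrow> ereal" where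
  "coalgebra_number C G = Inf {k. admits_coalgebra (C k) G}"

text \<open>The empty graph is initial, so it is a coalgebra of every comonad. Hence a parameter
  can be represented by coalgebras at the empty graph only if its value there is \<open>-\<infinity>\<close>, which
  the binary law in \<open>standard_parameter\<close> does not force (consider constant \<open>\<mu>\<close>).\<close>

lemma admits_coalgebra_empty:
  assumes "verts G = {}"
  shows "admits_coalgebra C G"
proof -
  have no_adj: "\<not> adj G u v" for u v
    using assms by transfer auto
  have "is_coalgebra C G (\<lambda>_. undefined)"
    using assms no_adj
    by (auto simp: is_coalgebra_def hom_def ident_def compose_def restrict_def)
  then show ?thesis
    unfolding admits_coalgebra_def by blast
qed

end

(* Let C(G) be the disjoint union of copies of F, one for each pair of a finite graph F with
   mu(F) <= k and a homomorphism f from F to G. The counit applies f; the comultiplication sends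
   the copy of F indexed by f to the copy indexed by the inclusion of that copy into C(G). For a
   coalgebra alpha on G, comparing the indices in the coassociativity law shows that, whenever alpha meets
   the copy indexed by f, alpha composed with f is the inclusion of that copy. Hence G is the disjoint union of the images
   of these f, and each of them is an isomorphic copy of some F with mu(F) <= k; if G is finite and
   nonempty, then mu(G) <= k. Conversely, if mu(G) <= k, the inclusion of the copy of G indexed by the
   identity is a coalgebra. For k <= l the grading map is the inclusion. Since only finite F
   occur, the vertices of C(G) can be encoded in any infinite type that contains the vertices of G. *)

theory Submission
  imports Defs
begin

section \<open>Graphs\<close>

lemma adj_verts: "adj G u v \<Longrightarrow> u \<in> verts G \<and> v \<in> verts G"
  by transfer auto

lemma adj_sym: "adj G u v \<Longrightarrow> adj G v u"
  by transfer (auto simp: sym_def)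

lemma adj_irrefl [simp]: "\<not> adj G v v"
  by transfer (auto simp: irrefl_def)

lemma graph_eqI:
  assumes "verts G = verts H" "\<And>u v. adj G u v \<longleftrightarrow> adj H u v"
  shows "G = H"
  using assms by transfer auto

text \<open>Cutting \<open>R\<close> down to its symmetric irreflexive part on \<open>V\<close>
  turns any set and relation into a graph.\<close>

lift_definition graph_of :: "'a set \<Rightarrow> ('a \<Rightarrow> 'a \<Rightarrow> bool) \<Rightarrow> 'a graph" is
  "\<lambda>V R. (V, {(u, v). u \<in> V \<and> v \<in> V \<and> u \<noteq> v \<and> R u v \<and> R v u})"
  by (auto simp: sym_def irrefl_def)

lemma verts_graph_of [simp]: "verts (graph_of V R) = V"
  by transfer simp

lemma adj_graph_of [simp]:
  "adj (graph_of V R) u v \<longleftrightarrow> u \<in> V \<and> v \<in> V \<and> u \<noteq> v \<and> R u v \<and> R v u"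
  by transfer simp

lemma verts_disjoint_union [simp]: "verts (disjoint_union G H) = verts G <+> verts H"
  by transfer auto

lemma adj_disjoint_union [simp]:
  "adj (disjoint_union G H) (Inl u) (Inl v) \<longleftrightarrow> adj G u v"
  "adj (disjoint_union G H) (Inr x) (Inr y) \<longleftrightarrow> adj H x y"
  "\<not> adj (disjoint_union G H) (Inl u) (Inr y)"
  "\<not> adj (disjoint_union G H) (Inr x) (Inl v)"
  by (transfer; force simp: map_prod_def image_iff split: prod.splits)+

section \<open>Induced subgraphs and values of standard parameters\<close>

definition induced :: "'a graph \<Rightarrow> 'a set \<Rightarrow> 'a graph" where
  "induced G S = graph_of (verts G \<inter> S) (adj G)"

lemma verts_induced [simp]: "verts (induced G S) = verts G \<inter> S"
  by (simp add: induced_def)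

lemma adj_induced [simp]: "adj (induced G S) u v \<longleftrightarrow> u \<in> S \<and> v \<in> S \<and> adj G u v"
  by (auto simp: induced_def adj_irrefl dest: adj_verts adj_sym)

lemma isomorphic_disjoint_union_induced:
  assumes "\<And>u v. adj G u v \<Longrightarrow> u \<in> A \<longleftrightarrow> v \<in> A"
  shows "isomorphic G (disjoint_union (induced G A) (induced G (- A)))"
  unfolding isomorphic_def
proof (intro exI conjI ballI)
  let ?f = "\<lambda>x. if x \<in> A then Inl x else Inr x"
  show "bij_betw ?f (verts G) (verts (disjoint_union (induced G A) (induced G (- A))))"
    by (rule bij_betwI') (auto split: if_splits)
  fix u v assume "u \<in> verts G" "v \<in> verts G"
  show "adj G u v \<longleftrightarrow> adj (disjoint_union (induced G A) (induced G (- A))) (?f u) (?f v)"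
    using assms[of u v] by auto
qed

text \<open>No edge joins different blocks of \<open>b\<close>, so G is the disjoint union of its
  blocks; induction on the number of vertices splits off one block at a time.\<close>

lemma standard_parameter_le_if_blocks_le:
  fixes b :: "'a \<Rightarrow> 'b"
  assumes \<mu>: "standard_parameter \<mu>"
  assumes "finite_graph G" "verts G \<noteq> {}"
    and "\<And>u v. adj G u v \<Longrightarrow> b u = b v"
    and "\<And>v. v \<in> verts G \<Longrightarrow> \<mu> (induced G {u. b u = b v}) \<le> k"
  shows "\<mu> G \<le> k"
  using assms(2-)
proof (induction "card (verts G)" arbitrary: G rule: less_induct)
  case less
  obtain v where v: "v \<in> verts G"
    using less.prems by auto
  define A where "A = {u. b u = b v}"
  have A: "\<mu> (induced G A) \<le> k"
    using less.prems(4)[OF v] by (simp add: A_def)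
  have fin: "finite_graph (induced G A)" "finite_graph (induced G (- A))"
    using less.prems(1) by (auto simp: finite_graph_def)
  show ?case
  \<comment> \<open>The recursion stops at a single block, not at the empty graph, whose value the
    bound on blocks does not control.\<close>
  proof (cases "verts G \<subseteq> A")
    case True
    then have "induced G A = G"
      by (intro graph_eqI) (auto dest: adj_verts)
    then show ?thesis
      using A by simp
  next
    case False
    have "\<mu> (induced G (- A)) \<le> k"
    proof (rule less.hyps)
      have "verts (induced G (- A)) \<subset> verts G"
        using v by (auto simp: A_def)
      then show "card (verts (induced G (- A))) < card (verts G)"
        using less.prems(1) by (simp add: finite_graph_def psubset_card_mono)
      show "verts (induced G (- A)) \<noteq> {}"
        using False by auto
      show "b u = b w" if "adj (induced G (- A)) u w" for u w
        using that less.prems(3) by auto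
      show "\<mu> (induced (induced G (- A)) {u. b u = b w}) \<le> k"
        if w: "w \<in> verts (induced G (- A))" for w
      proof -
        \<comment> \<open>The label of \<open>w\<close> differs from that of \<open>v\<close>, so
          the block of \<open>w\<close> in G avoids \<open>A\<close> entirely.\<close>
        have "induced (induced G (- A)) {u. b u = b w} = induced G {u. b u = b w}"
          using w by (intro graph_eqI) (auto simp: A_def)
        then show ?thesis
          using less.prems(4)[of w] w by simp
      qed
    qed (use fin in auto)
    moreover have "isomorphic G (disjoint_union (induced G A) (induced G (- A)))"
      using less.prems(3) by (intro isomorphic_disjoint_union_induced) (auto simp: A_def)
    then have "\<mu> G = max (\<mu> (induced G A)) (\<mu> (induced G (- A)))"
      using \<mu> fin unfolding standard_parameter_def by blast
    ultimately show ?thesis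
      using A by simp
  qed
qed

section \<open>Homomorphisms and their composition\<close>

lemma hom_extensional: "f \<in> hom G H \<Longrightarrow> f \<in> extensional (verts G)"
  by (auto simp: hom_def PiE_def)

lemma hom_verts: "f \<in> hom G H \<Longrightarrow> x \<in> verts G \<Longrightarrow> f x \<in> verts H"
  by (auto simp: hom_def)

lemma hom_adj: "f \<in> hom G H \<Longrightarrow> adj G x y \<Longrightarrow> adj H (f x) (f y)"
  by (auto simp: hom_def)

lemma restrict_in_hom:
  assumes "\<And>x. x \<in> verts G \<Longrightarrow> f x \<in> verts H" "\<And>x y. adj G x y \<Longrightarrow> adj H (f x) (f y)"
  shows "restrict f (verts G) \<in> hom G H"
  using assms by (auto simp: hom_def dest: adj_verts)

lemma compose_in_hom: "f \<in> hom G H \<Longrightarrow> g \<in> hom H K \<Longrightarrow> compose (verts G) g f \<in> hom G K"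
  unfolding compose_def by (intro restrict_in_hom) (auto intro: hom_verts hom_adj)

lemma ident_in_hom: "ident G \<in> hom G G"
  unfolding ident_def by (intro restrict_in_hom) auto

lemma ident_extensional: "ident G \<in> extensional (verts G)"
  by (simp add: ident_def)

lemma compose_ident: "f \<in> hom F G \<Longrightarrow> compose (verts F) (ident G) f = f"
  by (rule extensionalityI[of _ "verts F"])
    (auto simp: compose_eq ident_def hom_verts hom_extensional compose_extensional)


section \<open>Encoding maps from finite graphs\<close>

lemma infinite_inj_pair:
  assumes "infinite (UNIV :: 'a set)"
  shows "\<exists>p :: 'a \<times> 'a \<Rightarrow> 'a. inj p"
proof -
  obtain p :: "'a \<times> 'a \<Rightarrow> 'a" where "bij_betw p (UNIV \<times> UNIV) UNIV"
    using card_of_ordIso[THEN iffD2, OF card_of_Times_same_infinite[OF assms]] by blast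
  then show ?thesis
    by (auto simp: bij_betw_def)
qed

lemma infinite_inj_list:
  assumes "infinite (UNIV :: 'a set)"
  shows "\<exists>e :: 'a list \<Rightarrow> 'a. inj e"
proof -
  obtain p :: "'a \<times> 'a \<Rightarrow> 'a" where p: "inj p"
    using infinite_inj_pair[OF assms] by blast
  obtain c :: "nat \<Rightarrow> 'a" where c: "inj c"
    using assms infinite_countable_subset by blast
  \<comment> \<open>The seed \<open>c 0\<close> may itself be the code of a pair, so
    \<open>q\<close> separates only lists of equal length; the length is stored separately through
    \<open>c\<close>.\<close>
  define q where "q xs = foldr (\<lambda>x y. p (x, y)) xs (c 0)" for xs
  have q: "length xs = length ys \<Longrightarrow> q xs = q ys \<Longrightarrow> xs = ys" for xs ys
    by (induction xs ys rule: list_induct2) (auto simp: q_def dest: injD[OF p])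
  have "inj (\<lambda>xs. p (c (length xs), q xs))"
    by (rule injI) (auto dest!: injD[OF p] injD[OF c] intro: q)
  then show ?thesis
    by blast
qed

text \<open>A finite set is coded by the code of a chosen list of its elements, from which it can be
  read off.\<close>

lemma infinite_inj_on_finite_sets:
  assumes "infinite (UNIV :: 'a set)"
  shows "\<exists>e :: 'a set \<Rightarrow> 'a. inj_on e {A. finite A}"
proof -
  obtain e :: "'a list \<Rightarrow> 'a" where e: "inj e"
    using infinite_inj_list[OF assms] by blast
  define l :: "'a set \<Rightarrow> 'a list" where "l A = (SOME xs. set xs = A)" for A
  have l: "set (l A) = A" if "finite A" for A
    unfolding l_def using finite_list[OF that] by (rule someI_ex)
  have "inj_on (\<lambda>A. e (l A)) {A. finite A}"
    by (rule inj_onI) (metis injD[OF e] l mem_Collect_eq)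
  then show ?thesis
    by blast
qed

text \<open>A triple names the point x in the copy of F indexed by f. Extensionality makes it finite
  data. The codomain of f is not recorded, so one encoding serves all graphs G.\<close>

definition pointed_maps :: "('a graph \<times> ('a \<Rightarrow> 'a) \<times> 'a) set" where
  "pointed_maps = {(F, f, x). finite_graph F \<and> f \<in> extensional (verts F) \<and> x \<in> verts F}"

lemma infinite_inj_on_pointed_maps:
  assumes "infinite (UNIV :: 'a set)"
  shows "\<exists>e :: 'a graph \<times> ('a \<Rightarrow> 'a) \<times> 'a \<Rightarrow> 'a. inj_on e pointed_maps"
proof -
  obtain p :: "'a \<times> 'a \<Rightarrow> 'a" where p: "inj p"
    using infinite_inj_pair[OF assms] by blast
  obtain s :: "'a set \<Rightarrow> 'a" where s: "inj_on s {A. finite A}"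
    using infinite_inj_on_finite_sets[OF assms] by blast
  \<comment> \<open>The triple is determined by finitely many elements: the vertices, the edges
    (\<open>E\<close>), the graph of f (\<open>M\<close>) and x.\<close>
  define E where "E F = p ` {(u, v). adj F u v}" for F
  define M where "M F f = p ` ((\<lambda>x. (x, f x)) ` verts F)" for F and f :: "'a \<Rightarrow> 'a"
  define e where "e = (\<lambda>(F, f, x). p (p (s (verts F), s (E F)), p (s (M F f), x)))"
  have finE: "finite (E F)" if "finite_graph F" for F
  proof -
    have "{(u, v). adj F u v} \<subseteq> verts F \<times> verts F"
      by (auto dest: adj_verts)
    then show ?thesis
      using that unfolding E_def finite_graph_def by (blast intro: finite_subset)
  qed
  have "inj_on e pointed_maps"
  proof (rule inj_onI)
    fix t t' assume *: "t \<in> pointed_maps" "t' \<in> pointed_maps" "e t = e t'"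
    obtain F f x F' f' x' where t: "t = (F, f, x)" "t' = (F', f', x')"
      by (metis surj_pair)
    have m: "(F, f, x) \<in> pointed_maps" "(F', f', x') \<in> pointed_maps"
      and eq: "e (F, f, x) = e (F', f', x')"
      using * by (simp_all add: t)
    have eqs: "s (verts F) = s (verts F')" "s (E F) = s (E F')" "s (M F f) = s (M F' f')" "x = x'"
      using eq by (auto simp: e_def dest!: injD[OF p])
    have V: "verts F = verts F'"
      using m eqs by (intro inj_onD[OF s]) (auto simp: pointed_maps_def finite_graph_def)
    have "E F = E F'"
      using m eqs finE by (intro inj_onD[OF s]) (auto simp: pointed_maps_def)
    then have "{(u, v). adj F u v} = {(u, v). adj F' u v}"
      unfolding E_def by (simp add: inj_image_eq_iff[OF p])
    then have F: "F = F'"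
      using V by (intro graph_eqI) auto
    have "M F f = M F' f'"
      using m eqs
      by (intro inj_onD[OF s]) (auto simp: pointed_maps_def M_def finite_graph_def)
    then have "(\<lambda>x. (x, f x)) ` verts F = (\<lambda>x. (x, f' x)) ` verts F"
      unfolding M_def by (simp add: inj_image_eq_iff[OF p] F)
    then have "f y = f' y" if "y \<in> verts F" for y
      using that by blast
    then have "f = f'"
      using m F by (intro extensionalityI[of _ "verts F"]) (auto simp: pointed_maps_def)
    then show "t = t'"
      using F eqs by (simp add: t)
  qed
  then show ?thesis
    by blast
qed


section \<open>The comonad of a class of finite graphs\<close>

text \<open>With one encoding for all classes P, the graph of a smaller class is literally a
  subgraph of that of a larger one.\<close>

locale pointed_map_encoding =
  fixes enc :: "'a graph \<times> ('a \<Rightarrow> 'a) \<times> 'a \<Rightarrow> 'a"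
  assumes inj_enc: "inj_on enc pointed_maps"
begin

text \<open>Case analysis on a decoded vertex; off the codes the result is unspecified, so it is
  applied only to vertices of \<open>cofree P G\<close>.\<close>

definition on_code :: "('a graph \<Rightarrow> ('a \<Rightarrow> 'a) \<Rightarrow> 'a \<Rightarrow> 'b) \<Rightarrow> 'a \<Rightarrow> 'b" where
  "on_code t z = (case inv_into pointed_maps enc z of (F, f, x) \<Rightarrow> t F f x)"

lemma on_code_enc:
  assumes "finite_graph F" "f \<in> hom F G" "x \<in> verts F"
  shows "on_code t (enc (F, f, x)) = t F f x"
proof -
  have "(F, f, x) \<in> pointed_maps"
    using assms by (auto simp: pointed_maps_def hom_extensional)
  then show ?thesis
    by (simp add: on_code_def inv_into_f_f[OF inj_enc])
qed

lemma enc_eq_iff: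
  assumes "finite_graph F" "f \<in> hom F G" "x \<in> verts F"
    and "finite_graph F'" "f' \<in> hom F' G'" "x' \<in> verts F'"
  shows "enc (F, f, x) = enc (F', f', x') \<longleftrightarrow> F = F' \<and> f = f' \<and> x = x'"
  using assms inj_on_eq_iff[OF inj_enc, of "(F, f, x)" "(F', f', x')"]
  by (auto simp: pointed_maps_def hom_extensional)

text \<open>P enters through the vertex set alone: by injectivity of the code, an edge and its end
  points have the same F.\<close>

definition cofree :: "('a graph \<Rightarrow> bool) \<Rightarrow> 'a graph \<Rightarrow> 'a graph" where
  "cofree P G = graph_of
     {enc (F, f, x) |F f x. finite_graph F \<and> P F \<and> f \<in> hom F G \<and> x \<in> verts F}
     (\<lambda>z w. \<exists>F f x y. finite_graph F \<and> f \<in> hom F G \<and>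
        z = enc (F, f, x) \<and> w = enc (F, f, y) \<and> adj F x y)"

text \<open>The coproduct injection of the copy indexed by f. It is the same function for all G and
  P.\<close>

definition incl :: "'a graph \<Rightarrow> ('a \<Rightarrow> 'a) \<Rightarrow> 'a \<Rightarrow> 'a" where
  "incl F f = (\<lambda>x\<in>verts F. enc (F, f, x))"

text \<open>The density comonad of the discrete category of finite graphs in P. \<open>fmap\<close>
  and \<open>comult\<close> change only the index f and keep F and x, so they carry copies to
  copies.\<close>

definition cofree_comonad :: "('a graph \<Rightarrow> bool) \<Rightarrow> 'a comonad" where
  "cofree_comonad P =
     \<lparr>fobj = cofree P,
      fmap = (\<lambda>G H h. \<lambda>z\<in>verts (cofree P G). on_code (\<lambda>F f x. enc (F, compose (verts F) h f, x)) z),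
      counit = (\<lambda>G. \<lambda>z\<in>verts (cofree P G). on_code (\<lambda>F f x. f x) z),
      comult = (\<lambda>G. \<lambda>z\<in>verts (cofree P G). on_code (\<lambda>F f x. enc (F, incl F f, x)) z)\<rparr>"

section \<open>Vertices and edges of the cofree graph\<close>

lemma fobj_cofree [simp]: "fobj (cofree_comonad P) G = cofree P G"
  by (simp add: cofree_comonad_def)

lemma enc_in_cofree [intro]:
  "finite_graph F \<Longrightarrow> P F \<Longrightarrow> f \<in> hom F G \<Longrightarrow> x \<in> verts F \<Longrightarrow> enc (F, f, x) \<in> verts (cofree P G)"
  by (auto simp: cofree_def)

lemma in_cofreeE:
  assumes "z \<in> verts (cofree P G)"
  obtains F f x where "z = enc (F, f, x)" "finite_graph F" "P F" "f \<in> hom F G" "x \<in> verts F"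
  using assms by (auto simp: cofree_def)

lemma adj_enc_cofree:
  assumes "finite_graph F" "P F" "f \<in> hom F G" "adj F x y"
  shows "adj (cofree P G) (enc (F, f, x)) (enc (F, f, y))"
proof -
  have "enc (F, f, x) \<noteq> enc (F, f, y)"
    using assms adj_verts[OF assms(4)] by (auto simp: enc_eq_iff)
  then show ?thesis
    using assms adj_verts[OF assms(4)] adj_sym[OF assms(4)] unfolding cofree_def by auto
qed

lemma adj_cofreeE:
  assumes "adj (cofree P G) z w"
  obtains F f x y where "z = enc (F, f, x)" "w = enc (F, f, y)" "finite_graph F" "P F"
    "f \<in> hom F G" "x \<in> verts F" "y \<in> verts F" "adj F x y"
proof -
  have "z \<in> verts (cofree P G)"
    using adj_verts[OF assms] by blast
  then obtain F f x where z: "z = enc (F, f, x)" "finite_graph F" "P F" "f \<in> hom F G" "x \<in> verts F"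
    by (rule in_cofreeE)
  obtain F' f' x' y' where w: "z = enc (F', f', x')" "w = enc (F', f', y')" "finite_graph F'"
    "f' \<in> hom F' G" "adj F' x' y'"
    using assms by (auto simp: cofree_def)
  \<comment> \<open>The edge relation does not carry \<open>P F'\<close>; it is inherited from the
    vertex \<open>z\<close>.\<close>
  have "F = F' \<and> f = f' \<and> x = x'"
    using z w adj_verts[OF w(5)] enc_eq_iff by metis
  then show ?thesis
    using that z w adj_verts[OF w(5)] by blast
qed

text \<open>Each copy is an induced subgraph; this later lets the index of a copy reflect
  edges.\<close>

lemma adj_enc_cofreeD:
  assumes "adj (cofree P G) (enc (F, f, x)) (enc (F, f, y))"
    and F: "finite_graph F" "f \<in> hom F G" "x \<in> verts F" "y \<in> verts F"
  shows "adj F x y"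
  using assms(1)
proof (rule adj_cofreeE)
  fix F' f' x' y'
  assume eq: "enc (F, f, x) = enc (F', f', x')" "enc (F, f, y) = enc (F', f', y')"
    and F': "finite_graph F'" "f' \<in> hom F' G" "x' \<in> verts F'" "y' \<in> verts F'" "adj F' x' y'"
  show "adj F x y"
    using eq F'(5) enc_eq_iff[OF F(1-3) F'(1-3)] enc_eq_iff[OF F(1,2,4) F'(1,2,4)] by simp
qed

lemma incl_enc: "x \<in> verts F \<Longrightarrow> incl F f x = enc (F, f, x)"
  by (simp add: incl_def)

lemma incl_hom: "finite_graph F \<Longrightarrow> P F \<Longrightarrow> f \<in> hom F G \<Longrightarrow> incl F f \<in> hom F (cofree P G)"
  unfolding incl_def by (intro restrict_in_hom) (auto intro: adj_enc_cofree)

section \<open>Structure maps computed on codes\<close>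

context
  fixes F G :: "'a graph" and P f x
  assumes F: "finite_graph F" "P F" "f \<in> hom F G" "x \<in> verts F"
begin

lemma fmap_enc: "fmap (cofree_comonad P) G H h (enc (F, f, x)) = enc (F, compose (verts F) h f, x)"
  using F by (simp add: cofree_comonad_def enc_in_cofree on_code_enc)

lemma counit_enc: "counit (cofree_comonad P) G (enc (F, f, x)) = f x"
  using F by (simp add: cofree_comonad_def enc_in_cofree on_code_enc)

lemma comult_enc: "comult (cofree_comonad P) G (enc (F, f, x)) = enc (F, incl F f, x)"
  using F by (simp add: cofree_comonad_def enc_in_cofree on_code_enc)

lemma ident_cofree_enc: "ident (cofree P G) (enc (F, f, x)) = enc (F, f, x)"
  using F by (simp add: ident_def enc_in_cofree)

end

lemma cofree_extensional:
  "fmap (cofree_comonad P) G H h \<in> extensional (verts (cofree P G))"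
  "counit (cofree_comonad P) G \<in> extensional (verts (cofree P G))"
  "comult (cofree_comonad P) G \<in> extensional (verts (cofree P G))"
  by (simp_all add: cofree_comonad_def)

lemma cofree_homI:
  assumes "t \<in> extensional (verts (cofree P G))"
    and "\<And>F f x. finite_graph F \<Longrightarrow> P F \<Longrightarrow> f \<in> hom F G \<Longrightarrow> x \<in> verts F \<Longrightarrow> t (enc (F, f, x)) \<in> verts H"
    and "\<And>F f x y. finite_graph F \<Longrightarrow> P F \<Longrightarrow> f \<in> hom F G \<Longrightarrow> x \<in> verts F \<Longrightarrow> y \<in> verts F \<Longrightarrow>
      adj F x y \<Longrightarrow> adj H (t (enc (F, f, x))) (t (enc (F, f, y)))"
  shows "t \<in> hom (cofree P G) H"
proof -
  have "restrict t (verts (cofree P G)) \<in> hom (cofree P G) H"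
  proof (rule restrict_in_hom)
    show "t z \<in> verts H" if "z \<in> verts (cofree P G)" for z
      using that assms(2) by (auto elim!: in_cofreeE)
    show "adj H (t z) (t w)" if "adj (cofree P G) z w" for z w
      using that assms(3) by (auto elim!: adj_cofreeE)
  qed
  then show ?thesis
    using assms(1) by (simp add: extensional_restrict)
qed

text \<open>All vertices are codes, so the comonad laws can be checked on codes, where they become
  identities between indices.\<close>

lemma cofree_map_eqI:
  assumes "s \<in> extensional (verts (cofree P G))" "t \<in> extensional (verts (cofree P G))"
    and "\<And>F f x. finite_graph F \<Longrightarrow> P F \<Longrightarrow> f \<in> hom F G \<Longrightarrow> x \<in> verts F \<Longrightarrow>
      s (enc (F, f, x)) = t (enc (F, f, x))"
  shows "s = t"
  using assms by (intro extensionalityI[of s "verts (cofree P G)" t]) (auto elim!: in_cofreeE)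

lemma fmap_hom:
  "h \<in> hom G H \<Longrightarrow> fmap (cofree_comonad P) G H h \<in> hom (cofree P G) (cofree P H)"
  by (rule cofree_homI)
    (auto simp: fmap_enc cofree_extensional intro!: enc_in_cofree adj_enc_cofree compose_in_hom)

lemma counit_hom: "counit (cofree_comonad P) G \<in> hom (cofree P G) G"
  by (rule cofree_homI) (auto simp: counit_enc cofree_extensional intro: hom_verts hom_adj)

lemma comult_hom: "comult (cofree_comonad P) G \<in> hom (cofree P G) (cofree P (cofree P G))"
  by (rule cofree_homI)
    (auto simp: comult_enc cofree_extensional intro!: enc_in_cofree adj_enc_cofree incl_hom)

text \<open>Computes the index that arises when \<open>fmap\<close> is applied after
  \<open>comult\<close>: a map restricted to one copy.\<close>

lemma compose_incl:
  assumes "\<And>x. x \<in> verts F \<Longrightarrow> t (enc (F, f, x)) = s x" "s \<in> extensional (verts F)"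
  shows "compose (verts F) t (incl F f) = s"
  using assms
  by (intro extensionalityI[of _ "verts F"]) (auto simp: compose_eq incl_def compose_extensional)

section \<open>Comonad laws and comparison of classes\<close>

lemma is_endofunctor_cofree: "is_endofunctor (cofree_comonad P)"
  unfolding is_endofunctor_def fobj_cofree
proof (intro conjI allI ballI)
  fix G H K :: "'a graph" and f g
  show "fmap (cofree_comonad P) G G (ident G) = ident (cofree P G)"
    by (rule cofree_map_eqI[where P = P and G = G])
      (auto simp: cofree_extensional ident_extensional fmap_enc compose_ident ident_cofree_enc)
  assume f: "f \<in> hom G H"
  then show "fmap (cofree_comonad P) G H f \<in> hom (cofree P G) (cofree P H)"
    by (rule fmap_hom)
  assume g: "g \<in> hom H K"
  show "fmap (cofree_comonad P) G K (compose (verts G) g f) =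
    compose (verts (cofree P G)) (fmap (cofree_comonad P) H K g) (fmap (cofree_comonad P) G H f)"
  proof (rule cofree_map_eqI[where P = P and G = G])
    fix F e x assume F: "finite_graph F" "P F" "e \<in> hom F G" "x \<in> verts F"
    have "compose (verts F) (compose (verts G) g f) e = compose (verts F) g (compose (verts F) f e)"
      using F by (auto simp: compose_def restrict_def fun_eq_iff hom_verts)
    then show "fmap (cofree_comonad P) G K (compose (verts G) g f) (enc (F, e, x)) =
      compose (verts (cofree P G)) (fmap (cofree_comonad P) H K g) (fmap (cofree_comonad P) G H f)
        (enc (F, e, x))"
      using F f by (simp add: compose_eq fmap_enc enc_in_cofree compose_in_hom)
  qed (auto simp: cofree_extensional compose_extensional)
qed

lemma is_comonad_cofree: "is_comonad (cofree_comonad P)"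
  unfolding is_comonad_def
proof (intro conjI allI)
  let ?C = "cofree_comonad P"
  show "is_endofunctor ?C"
    by (rule is_endofunctor_cofree)
  show "natural_transformation ?C id_functor (counit ?C)"
    unfolding natural_transformation_def
  proof (intro conjI allI ballI)
    show "counit ?C G \<in> hom (fobj ?C G) (fobj id_functor G)" for G
      by (simp add: id_functor_def counit_hom)
    show "compose (verts (fobj ?C G)) (counit ?C H) (fmap ?C G H h) =
      compose (verts (fobj ?C G)) (fmap id_functor G H h) (counit ?C G)" if "h \<in> hom G H" for G H h
      unfolding fobj_cofree using that
      by (intro cofree_map_eqI[where P = P and G = G])
        (auto simp: compose_extensional compose_eq enc_in_cofree fmap_enc counit_enc id_functor_def
          compose_in_hom)
  qed
  show "natural_transformation ?C (comp_functor ?C ?C) (comult ?C)"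
    unfolding natural_transformation_def
  proof (intro conjI allI ballI)
    show "comult ?C G \<in> hom (fobj ?C G) (fobj (comp_functor ?C ?C) G)" for G
      by (simp add: comp_functor_def comult_hom)
    show "compose (verts (fobj ?C G)) (comult ?C H) (fmap ?C G H h) =
      compose (verts (fobj ?C G)) (fmap (comp_functor ?C ?C) G H h) (comult ?C G)"
      if h: "h \<in> hom G H" for G H h
      unfolding fobj_cofree
    proof (rule cofree_map_eqI[where P = P and G = G])
      fix F f x assume F: "finite_graph F" "P F" "f \<in> hom F G" "x \<in> verts F"
      \<comment> \<open>The right side of the square postcomposes the index \<open>incl F f\<close>
        with \<open>fmap\<close> of \<open>h\<close>; the left side takes the injection for the new
        index.\<close>
      have "compose (verts F) (fmap ?C G H h) (incl F f) = incl F (compose (verts F) h f)"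
        using F by (intro compose_incl) (auto simp: fmap_enc incl_def)
      then show "compose (verts (cofree P G)) (comult ?C H) (fmap ?C G H h) (enc (F, f, x)) =
        compose (verts (cofree P G)) (fmap (comp_functor ?C ?C) G H h) (comult ?C G) (enc (F, f, x))"
        using F h
        by (simp add: compose_eq enc_in_cofree fmap_enc comult_enc comp_functor_def compose_in_hom
            incl_hom)
    qed (auto simp: compose_extensional)
  qed
  fix G
  show "compose (verts (fobj ?C G)) (counit ?C (fobj ?C G)) (comult ?C G) = ident (fobj ?C G)"
    unfolding fobj_cofree
    by (rule cofree_map_eqI[where P = P and G = G])
      (auto simp: compose_extensional ident_extensional compose_eq enc_in_cofree comult_enc
        counit_enc incl_hom ident_cofree_enc incl_enc)
  show "compose (verts (fobj ?C G)) (fmap ?C (fobj ?C G) G (counit ?C G)) (comult ?C G) =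
    ident (fobj ?C G)"
    unfolding fobj_cofree
  proof (rule cofree_map_eqI[where P = P and G = G])
    fix F f x assume F: "finite_graph F" "P F" "f \<in> hom F G" "x \<in> verts F"
    \<comment> \<open>The counit restricted to the copy indexed by f is f itself, so the original
      index returns.\<close>
    have "compose (verts F) (counit ?C G) (incl F f) = f"
      using F by (intro compose_incl) (auto simp: counit_enc hom_extensional)
    then show "compose (verts (cofree P G)) (fmap ?C (cofree P G) G (counit ?C G)) (comult ?C G)
      (enc (F, f, x)) = ident (cofree P G) (enc (F, f, x))"
      using F by (simp add: compose_eq enc_in_cofree comult_enc fmap_enc incl_hom ident_def)
  qed (auto simp: compose_extensional ident_extensional)
  show "compose (verts (fobj ?C G)) (comult ?C (fobj ?C G)) (comult ?C G) =
    compose (verts (fobj ?C G)) (fmap ?C (fobj ?C G) (fobj ?C (fobj ?C G)) (comult ?C G))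
      (comult ?C G)"
    unfolding fobj_cofree
  proof (rule cofree_map_eqI[where P = P and G = G])
    fix F f x assume F: "finite_graph F" "P F" "f \<in> hom F G" "x \<in> verts F"
    \<comment> \<open>These are the indices produced by the right and the left side of
      coassociativity.\<close>
    have "compose (verts F) (comult ?C G) (incl F f) = incl F (incl F f)"
      using F by (intro compose_incl) (auto simp: comult_enc incl_def)
    then show "compose (verts (cofree P G)) (comult ?C (cofree P G)) (comult ?C G) (enc (F, f, x)) =
      compose (verts (cofree P G)) (fmap ?C (cofree P G) (cofree P (cofree P G)) (comult ?C G))
        (comult ?C G) (enc (F, f, x))"
      using F by (simp add: compose_eq enc_in_cofree comult_enc fmap_enc incl_hom)
  qed (auto simp: compose_extensional)
qed

text \<open>The structure maps act on codes by formulas free of P and Q, so they commute with the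
  inclusion, which is the identity function with a larger codomain.\<close>

lemma comonad_morphism_cofree:
  assumes PQ: "\<And>F. P F \<Longrightarrow> Q F"
  shows "comonad_morphism (cofree_comonad P) (cofree_comonad Q) (\<lambda>G. ident (cofree P G))"
  unfolding comonad_morphism_def natural_transformation_def fobj_cofree
proof (intro conjI allI ballI)
  let ?C = "cofree_comonad P" and ?D = "cofree_comonad Q" and ?t = "\<lambda>G. ident (cofree P G)"
  fix G
  show t_hom: "?t H \<in> hom (cofree P H) (cofree Q H)" for H
    using PQ
    by (intro cofree_homI)
      (auto simp: ident_extensional ident_cofree_enc intro!: enc_in_cofree adj_enc_cofree)
  show "compose (verts (cofree P G)) (?t H) (fmap ?C G H h) =
    compose (verts (cofree P G)) (fmap ?D G H h) (?t G)" if "h \<in> hom G H" for H h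
    using that PQ
    by (intro cofree_map_eqI[where P = P and G = G])
      (auto simp: compose_extensional compose_eq enc_in_cofree fmap_enc ident_cofree_enc compose_in_hom)
  show "compose (verts (cofree P G)) (counit ?D G) (?t G) = counit ?C G"
    using PQ
    by (intro cofree_map_eqI[where P = P and G = G])
      (auto simp: compose_extensional cofree_extensional compose_eq enc_in_cofree counit_enc ident_cofree_enc)
  show "compose (verts (cofree P G)) (comult ?D G) (?t G) =
    compose (verts (cofree P G)) (?t (cofree Q G))
      (compose (verts (cofree P G)) (fmap ?C (cofree P G) (cofree Q G) (?t G)) (comult ?C G))"
  proof (rule cofree_map_eqI[where P = P and G = G])
    fix F f x assume F: "finite_graph F" "P F" "f \<in> hom F G" "x \<in> verts F"
    \<comment> \<open>The inclusion is also applied to the inner index, and fixes it because the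
      copy of F already lies in \<open>cofree P G\<close>.\<close>
    have "compose (verts F) (?t G) (incl F f) = incl F f"
      using F by (intro compose_incl) (auto simp: ident_cofree_enc incl_def)
    then show "compose (verts (cofree P G)) (comult ?D G) (?t G) (enc (F, f, x)) =
      compose (verts (cofree P G)) (?t (cofree Q G))
        (compose (verts (cofree P G)) (fmap ?C (cofree P G) (cofree Q G) (?t G)) (comult ?C G))
          (enc (F, f, x))"
      using F PQ
      by (simp add: compose_eq enc_in_cofree comult_enc fmap_enc ident_cofree_enc incl_hom)
  qed (auto simp: compose_extensional)
qed

section \<open>Coalgebras and their blocks\<close>

lemma admits_coalgebra_cofreeI:
  assumes G: "finite_graph G" "P G"
  shows "admits_coalgebra (cofree_comonad P) G"
  unfolding admits_coalgebra_def is_coalgebra_def fobj_cofree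
proof (intro exI conjI)
  let ?C = "cofree_comonad P" and ?\<alpha> = "incl G (ident G)"
  note G = G ident_in_hom[of G]
  show \<alpha>: "?\<alpha> \<in> hom G (cofree P G)"
    using G by (rule incl_hom)
  show "compose (verts G) (counit ?C G) ?\<alpha> = ident G"
    using G by (intro compose_incl) (auto simp: counit_enc ident_extensional)
  \<comment> \<open>Coassociativity compares the index \<open>incl G (ident G)\<close> from
    \<open>comult\<close> with \<alpha> after the identity from \<open>fmap\<close>.\<close>
  have "compose (verts G) ?\<alpha> (ident G) = ?\<alpha>"
    by (auto simp: compose_def ident_def incl_def restrict_def)
  then show "compose (verts G) (comult ?C G) ?\<alpha> = compose (verts G) (fmap ?C G (cofree P G) ?\<alpha>) ?\<alpha>"
    using G by (auto simp: compose_def incl_def comult_enc fmap_enc restrict_def fun_eq_iff)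
qed

lemma coalgebra_cofree_blocks:
  assumes "is_coalgebra (cofree_comonad P) G \<alpha>"
  obtains b :: "'a \<Rightarrow> 'a graph \<times> ('a \<Rightarrow> 'a)" where
    "\<And>u v. adj G u v \<Longrightarrow> b u = b v"
    "\<And>v. v \<in> verts G \<Longrightarrow>
       \<exists>F. finite_graph F \<and> P F \<and> isomorphic F (induced G {u. b u = b v})"
proof
  let ?C = "cofree_comonad P"
  \<comment> \<open>The label of v is the copy containing \<open>\<alpha> v\<close>; an edge of G is
    sent into one copy, so its ends share a label.\<close>
  define b where "b = (\<lambda>v. if v \<in> verts G then on_code (\<lambda>F f x. (F, f)) (\<alpha> v) else undefined)"
  have \<alpha>: "\<alpha> \<in> hom G (cofree P G)"
    and counit: "compose (verts G) (counit ?C G) \<alpha> = ident G"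
    and comult: "compose (verts G) (comult ?C G) \<alpha> = compose (verts G) (fmap ?C G (cofree P G) \<alpha>) \<alpha>"
    using assms by (auto simp: is_coalgebra_def)
  show "b u = b v" if "adj G u v" for u v
    using hom_adj[OF \<alpha> that]
  proof (rule adj_cofreeE)
    fix F f x y
    assume "\<alpha> u = enc (F, f, x)" "\<alpha> v = enc (F, f, y)" "finite_graph F" "f \<in> hom F G"
      "x \<in> verts F" "y \<in> verts F"
    then show ?thesis
      using adj_verts[OF that] by (simp add: b_def on_code_enc)
  qed
  fix v assume v: "v \<in> verts G"
  \<comment> \<open>A single vertex u sent into the copy controls all of F: coassociativity at u
    equates whole indices, not only their values at x.\<close>
  have *: "f x = u \<and> (\<forall>y\<in>verts F. \<alpha> (f y) = enc (F, f, y))"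
    if u: "u \<in> verts G" "\<alpha> u = enc (F, f, x)"
      and F: "finite_graph F" "P F" "f \<in> hom F G" "x \<in> verts F" for u F f x
  proof
    show "f x = u"
      using fun_cong[OF counit, of u] u F by (simp add: compose_eq ident_def counit_enc)
    have "enc (F, incl F f, x) = enc (F, compose (verts F) \<alpha> f, x)"
      using fun_cong[OF comult, of u] u F by (simp add: compose_eq comult_enc fmap_enc)
    then have eq: "incl F f = compose (verts F) \<alpha> f"
      using enc_eq_iff[OF F(1) incl_hom[where P = P, OF F(1-3)] F(4,1)
          compose_in_hom[OF F(3) \<alpha>] F(4)] by simp
    show "\<forall>y\<in>verts F. \<alpha> (f y) = enc (F, f, y)"
    proof
      fix y assume "y \<in> verts F"
      then show "\<alpha> (f y) = enc (F, f, y)"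
        using fun_cong[OF eq, of y] by (simp add: compose_eq incl_enc)
    qed
  qed
  obtain F f x where \<alpha>v: "\<alpha> v = enc (F, f, x)"
    and F: "finite_graph F" "P F" "f \<in> hom F G" "x \<in> verts F"
    using hom_verts[OF \<alpha> v] by (rule in_cofreeE)
  have \<alpha>f: "\<alpha> (f y) = enc (F, f, y)" if "y \<in> verts F" for y
    using *[OF v \<alpha>v F] that by blast
  have bv: "b v = (F, f)"
    using v F by (simp add: b_def \<alpha>v on_code_enc)
  \<comment> \<open>If \<alpha> sends u to the point x' of this copy, the counit law gives
    \<open>f x' = u\<close>; conversely \<alpha> sends every \<open>f y\<close> into this
    copy.\<close>
  have block: "verts (induced G {u. b u = b v}) = f ` verts F"
  proof (intro equalityI subsetI)
    fix u assume "u \<in> verts (induced G {u. b u = b v})"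
    then have u: "u \<in> verts G" "b u = (F, f)"
      using bv by auto
    obtain F' f' x' where \<alpha>u: "\<alpha> u = enc (F', f', x')"
      and F': "finite_graph F'" "P F'" "f' \<in> hom F' G" "x' \<in> verts F'"
      using hom_verts[OF \<alpha> u(1)] by (rule in_cofreeE)
    have "F' = F" "f' = f"
      using u F' by (auto simp: b_def \<alpha>u on_code_enc)
    then show "u \<in> f ` verts F"
      using *[OF u(1) \<alpha>u F'] F' by auto
  next
    fix u assume "u \<in> f ` verts F"
    then obtain y where y: "y \<in> verts F" "u = f y"
      by blast
    then have "u \<in> verts G"
      using hom_verts[OF F(3)] by simp
    then show "u \<in> verts (induced G {u. b u = b v})"
      using y F by (simp add: bv) (simp add: b_def \<alpha>f on_code_enc)
  qed
  have "isomorphic F (induced G {u. b u = b v})"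
    unfolding isomorphic_def
  proof (intro exI conjI ballI)
    \<comment> \<open>\<alpha> after f is the injective inclusion of the copy.\<close>
    have "inj_on f (verts F)"
    proof (rule inj_onI)
      fix y y' assume y: "y \<in> verts F" "y' \<in> verts F" and "f y = f y'"
      then have "enc (F, f, y) = enc (F, f, y')"
        using \<alpha>f[OF y(1)] \<alpha>f[OF y(2)] by simp
      then show "y = y'"
        using enc_eq_iff[OF F(1,3) y(1) F(1,3) y(2)] by simp
    qed
    then show "bij_betw f (verts F) (verts (induced G {u. b u = b v}))"
      unfolding block by (simp add: bij_betw_def)
    fix y y' assume y: "y \<in> verts F" "y' \<in> verts F"
    have "f y \<in> verts (induced G {u. b u = b v})" "f y' \<in> verts (induced G {u. b u = b v})"
      unfolding block using y by auto
    then have in_block: "adj (induced G {u. b u = b v}) (f y) (f y') \<longleftrightarrow> adj G (f y) (f y')"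
      by simp
    \<comment> \<open>\<alpha> carries the edge back into the copy, which is induced.\<close>
    have "adj F y y'" if "adj G (f y) (f y')"
    proof -
      have "adj (cofree P G) (enc (F, f, y)) (enc (F, f, y'))"
        using hom_adj[OF \<alpha> that] y by (simp add: \<alpha>f)
      then show ?thesis
        by (rule adj_enc_cofreeD[OF _ F(1,3) y])
    qed
    then show "adj F y y' \<longleftrightarrow> adj (induced G {u. b u = b v}) (f y) (f y')"
      unfolding in_block using hom_adj[OF F(3)] by blast
  qed
  then show "\<exists>F. finite_graph F \<and> P F \<and> isomorphic F (induced G {u. b u = b v})"
    using F by blast
qed

lemma admits_coalgebra_cofree_iff:
  assumes \<mu>: "standard_parameter \<mu>"
    and G: "finite_graph G" "verts G = {} \<longrightarrow> \<mu> G = -\<infinity>"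
  shows "admits_coalgebra (cofree_comonad (\<lambda>F. \<mu> F \<le> k)) G \<longleftrightarrow> \<mu> G \<le> k"
proof
  show "admits_coalgebra (cofree_comonad (\<lambda>F. \<mu> F \<le> k)) G" if "\<mu> G \<le> k"
    using G(1) that by (rule admits_coalgebra_cofreeI)
  assume "admits_coalgebra (cofree_comonad (\<lambda>F. \<mu> F \<le> k)) G"
  then obtain \<alpha> where "is_coalgebra (cofree_comonad (\<lambda>F. \<mu> F \<le> k)) G \<alpha>"
    by (auto simp: admits_coalgebra_def)
  then show "\<mu> G \<le> k"
  proof (rule coalgebra_cofree_blocks)
    fix b :: "'a \<Rightarrow> 'a graph \<times> ('a \<Rightarrow> 'a)"
    assume b: "\<And>u v. adj G u v \<Longrightarrow> b u = b v"
      and iso: "\<And>v. v \<in> verts G \<Longrightarrow>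
        \<exists>F. finite_graph F \<and> \<mu> F \<le> k \<and> isomorphic F (induced G {u. b u = b v})"
    have block_le: "\<mu> (induced G {u. b u = b v}) \<le> k" if v: "v \<in> verts G" for v
    proof -
      obtain F where F: "finite_graph F" "\<mu> F \<le> k" "isomorphic F (induced G {u. b u = b v})"
        using iso[OF v] by blast
      have "finite_graph (induced G {u. b u = b v})"
        using G(1) by (simp add: finite_graph_def)
      then have "\<mu> F = \<mu> (induced G {u. b u = b v})"
        using \<mu> F unfolding standard_parameter_def graph_parameter_def by blast
      then show ?thesis
        using F(2) by simp
    qed
    show "\<mu> G \<le> k"
    proof (cases "verts G = {}")
      case False
      show ?thesis
        using standard_parameter_le_if_blocks_le[OF \<mu> G(1) False b block_le] by simp
    \<comment> \<open>The empty graph has no blocks, so its bound comes from the value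
      -\<infinity>.\<close>
    qed (use G(2) in simp)
  qed
qed

lemma graded_comonad_cofree:
  "graded_comonad (\<lambda>k. cofree_comonad (\<lambda>F. \<mu> F \<le> k)) (\<lambda>k l G. ident (cofree (\<lambda>F. \<mu> F \<le> k) G))"
  unfolding graded_comonad_def
proof (intro conjI allI impI)
  fix k j l :: ereal and G
  show "is_comonad (cofree_comonad (\<lambda>F. \<mu> F \<le> k))"
    by (rule is_comonad_cofree)
  show "comonad_morphism (cofree_comonad (\<lambda>F. \<mu> F \<le> k)) (cofree_comonad (\<lambda>F. \<mu> F \<le> l))
    (\<lambda>G. ident (cofree (\<lambda>F. \<mu> F \<le> k) G))" if "k \<le> l"
    using that by (intro comonad_morphism_cofree) auto
  assume "k \<le> j \<and> j \<le> l"
  \<comment> \<open>The identity at grade j is \<open>undefined\<close> off its own vertices, so it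
    must be seen to fix those of grade k.\<close>
  then have "verts (cofree (\<lambda>F. \<mu> F \<le> k) G) \<subseteq> verts (cofree (\<lambda>F. \<mu> F \<le> j) G)"
    by (auto elim!: in_cofreeE)
  then show "ident (cofree (\<lambda>F. \<mu> F \<le> k) G) =
    compose (verts (fobj (cofree_comonad (\<lambda>F. \<mu> F \<le> k)) G)) (ident (cofree (\<lambda>F. \<mu> F \<le> j) G))
      (ident (cofree (\<lambda>F. \<mu> F \<le> k) G))"
    by (auto simp: ident_def compose_def restrict_def fun_eq_iff)
qed

end

theorem mainTheorem3:
  fixes \<mu> :: "'a graph \<Rightarrow> ereal"
  assumes "infinite (UNIV :: 'a set)"
    and "standard_parameter \<mu>"
  shows "\<exists>C g. graded_comonad C g \<and>
    (\<forall>G :: 'a graph. finite_graph G \<and> (verts G = {} \<longrightarrow> \<mu> G = -\<infinity>) \<longrightarrow>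
       (\<forall>k. \<mu> G \<le> k \<longleftrightarrow> admits_coalgebra (C k) G) \<and>
       coalgebra_number C G = \<mu> G)"
proof -
  obtain enc :: "'a graph \<times> ('a \<Rightarrow> 'a) \<times> 'a \<Rightarrow> 'a" where "inj_on enc pointed_maps"
    using infinite_inj_on_pointed_maps[OF assms(1)] by blast
  then interpret pointed_map_encoding enc
    by unfold_locales
  let ?C = "\<lambda>k. cofree_comonad (\<lambda>F. \<mu> F \<le> k)"
  have iff: "admits_coalgebra (?C k) G \<longleftrightarrow> \<mu> G \<le> k"
    if "finite_graph G \<and> (verts G = {} \<longrightarrow> \<mu> G = -\<infinity>)" for G k
    using that assms(2) by (intro admits_coalgebra_cofree_iff) auto
  have "coalgebra_number ?C G = \<mu> G"
    if "finite_graph G \<and> (verts G = {} \<longrightarrow> \<mu> G = -\<infinity>)" for G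
    \<comment> \<open>The grades admitting a coalgebra form the closed ray above
      \<open>\<mu> G\<close>, which attains its infimum.\<close>
    using cInf_atLeast[of "\<mu> G"] by (simp add: coalgebra_number_def iff[OF that] flip: atLeast_def)
  then show ?thesis
    using graded_comonad_cofree[of \<mu>] iff by blast
qed

end
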